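(* Let $0<q<1$, $x\in[0,1]$, $n\in\mathbb{N}$ and $\alpha\ge 0$, and define $\gamma=\alpha/(1-q)$. Then, for $0\le k\le n$, the following identities hold: (i) $$\prod_{i=0}^{k-1}\bigl(x+\alpha[i]_q\bigr)=(x+\gamma)^k\left(\frac{\gamma}{x+\gamma};q\right)_k;$$ (ii) $$\prod_{i=0}^{n-k-1}\bigl(1-q^i x+\alpha[i]_q\bigr)=(1+\gamma)^{n-k}\left(\frac{x+\gamma}{1+\gamma};q\right)_{n-k}.$$
   Context: For $i\in\mathbb{N}_0$, the $q$-integer is $[i]_q=1+q+\cdots+q^{i-1}$, with $[0]_q=0$. The $q$-Pochhammer symbol is $(a;q)_0=1$ and $(a;q)_m=\prod_{j=0}^{m-1}(1-aq^j)$ for $m\in\mathbb{N}$. Here $k$ is an integer, and empty products equal $1$. *)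

theory Defs
  imports Complex_Main
begin

definition q_integer :: "real \<Rightarrow> nat \<Rightarrow> real" where
  "q_integer q i = (\<Sum>j<i. q ^ j)"

definition q_pochhammer :: "real \<Rightarrow> real \<Rightarrow> nat \<Rightarrow> real" where
  "q_pochhammer a q m = (\<Prod>j<m. (1 - a * q ^ j))"

end

theory Submission
  imports Defs
begin

text \<open>Summing the geometric series turns \<open>\<alpha> [i]\<^sub>q\<close> into \<open>\<gamma> - \<gamma> q\<^sup>i\<close>, so that the factors of the two
  products become \<open>(x + \<gamma>) - \<gamma> q\<^sup>i\<close> and \<open>(1 + \<gamma>) - (x + \<gamma>) q\<^sup>i\<close>. Both have the form \<open>b - a q\<^sup>i\<close>,
  and pulling \<open>b\<close> out of every factor leaves the \<open>q\<close>-Pochhammer symbol of \<open>a / b\<close>; this is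
  \<open>prod_affine_power_eq_q_pochhammer\<close>. The only division that can degenerate is \<open>\<gamma> / (x + \<gamma>)\<close>, and
  as \<open>x\<close> and \<open>\<gamma>\<close> are nonnegative this happens only when \<open>\<gamma> = 0\<close> as well.\<close>

lemma mult_q_integer_eq:
  assumes "q \<noteq> 1"
  shows "\<alpha> * q_integer q i = \<alpha> / (1 - q) - \<alpha> / (1 - q) * q ^ i"
proof -
  have "q_integer q i = (1 - q ^ i) / (1 - q)"
    using assms by (simp add: q_integer_def sum_gp_strict)
  then show ?thesis
    by (simp add: right_diff_distrib diff_divide_distrib)
qed

text \<open>The hypothesis admits \<open>a = b = 0\<close>: there \<open>a / b = 0\<close>, the Pochhammer symbol is \<open>1\<close>, and both
  sides are \<open>0 ^ m\<close>.\<close>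

lemma prod_affine_power_eq_q_pochhammer:
  assumes "b = 0 \<Longrightarrow> a = 0"
  shows "(\<Prod>i<m. b - a * q ^ i) = b ^ m * q_pochhammer (a / b) q m"
proof -
  have "b - a * q ^ i = b * (1 - a / b * q ^ i)" for i
    using assms by (cases "b = 0") (simp_all add: right_diff_distrib)
  then show ?thesis
    by (simp add: q_pochhammer_def prod.distrib)
qed

theorem lemma2p1:
  fixes q x \<alpha> \<gamma> :: real and n k :: nat
  assumes "0 < q" and "q < 1"
    and "x \<in> {0..1}"
    and "1 \<le> n"
    and "0 \<le> \<alpha>"
    and "\<gamma> = \<alpha> / (1 - q)"
    and "k \<le> n"
  shows "(\<Prod>i<k. x + \<alpha> * q_integer q i) = (x + \<gamma>) ^ k * q_pochhammer (\<gamma> / (x + \<gamma>)) q k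
      \<and> (\<Prod>i<n - k. 1 - q ^ i * x + \<alpha> * q_integer q i)
           = (1 + \<gamma>) ^ (n - k) * q_pochhammer ((x + \<gamma>) / (1 + \<gamma>)) q (n - k)"
proof
  have \<gamma>_nonneg: "0 \<le> \<gamma>"
    using assms by simp
  have q_int: "\<alpha> * q_integer q i = \<gamma> - \<gamma> * q ^ i" for i
    using assms mult_q_integer_eq[of q \<alpha> i] by simp
  have "(\<Prod>i<k. x + \<alpha> * q_integer q i) = (\<Prod>i<k. (x + \<gamma>) - \<gamma> * q ^ i)"
    by (simp add: q_int algebra_simps)
  also have "\<dots> = (x + \<gamma>) ^ k * q_pochhammer (\<gamma> / (x + \<gamma>)) q k"
    using \<gamma>_nonneg assms(3) by (intro prod_affine_power_eq_q_pochhammer) auto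
  finally show "(\<Prod>i<k. x + \<alpha> * q_integer q i)
      = (x + \<gamma>) ^ k * q_pochhammer (\<gamma> / (x + \<gamma>)) q k" .
  have "(\<Prod>i<n - k. 1 - q ^ i * x + \<alpha> * q_integer q i)
      = (\<Prod>i<n - k. (1 + \<gamma>) - (x + \<gamma>) * q ^ i)"
    by (simp add: q_int algebra_simps)
  also have "\<dots> = (1 + \<gamma>) ^ (n - k) * q_pochhammer ((x + \<gamma>) / (1 + \<gamma>)) q (n - k)"
    using \<gamma>_nonneg by (intro prod_affine_power_eq_q_pochhammer) auto
  finally show "(\<Prod>i<n - k. 1 - q ^ i * x + \<alpha> * q_integer q i)
      = (1 + \<gamma>) ^ (n - k) * q_pochhammer ((x + \<gamma>) / (1 + \<gamma>)) q (n - k)" .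
qed

end
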